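(* Let $n\ge 1$, let $\lambda\in Par_{\le 2n}$, $\mu\in Par_{\le n}$ with $\mu\subseteq\lambda$, and let $T\in LRS_{2n}(\lambda/\mu)$ have weight $\nu$ (an even partition), with conjugate partition $\nu^t=(\nu^t_1,\dots,\nu^t_{\nu_1})$. Let $J_1,\dots,J_{\nu_1}$ be the decomposition of $D(\lambda/\mu)$ into vertical strips associated with $T$ (described in the context), so that $J_k$ has $\nu^t_k\in 2\mathbb{Z}$ cells, filled in $T$ from top to bottom with $1,2,\dots,\nu^t_k$. Let $Q=\lozenge T$ be the tableau of shape $\lambda/\mu$ obtained by relabelling every cell of $J_k$ with the entry $k$, for $k=1,\dots,\nu_1$. Then $Q\in\widetilde{Rec}_{2n}(\lambda/\mu)$, $Q$ has weight $(Q[1],Q[2],\dots)=\nu^t$, and the map $\lozenge:LRS_{2n}(\lambda/\mu)\to\widetilde{Rec}_{2n}(\lambda/\mu)$, $T\mapsto\lozenge T$, is a bijection.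
   Context: Partitions are identified with Young diagrams $D(\gamma)$ (cells $(i,j)$, $1\le i\le\ell(\gamma)$, $1\le j\le\gamma_i$); $Par_{\le m}$ is the set of partitions with at most $m$ nonzero parts. A partition $\gamma$ is even if $\gamma_{2i-1}=\gamma_{2i}$ for all $i\ge1$ (all columns have even length). $SST_{2n}(\lambda/\mu)$ is the set of semistandard tableaux of skew shape $\lambda/\mu$ with entries in $\{1,\dots,2n\}$ (rows weakly increasing, columns strictly increasing). For a tableau $U$, $U[k]$ is the number of entries equal to $k$. A word $u_1\cdots u_N$ is Yamanouchi if for every $k$ the weight of $u_1\cdots u_k$ is a partition. $LRS_{2n}(\lambda/\mu)$ (Littlewood–Richardson–Sundaram tableaux), for $\lambda\in Par_{\le2n}$, $\mu\in Par_{\le n}$: the set of $T\in SST_{2n}(\lambda/\mu)$ such that (i) the word obtained by reading the columns of $T$ from right to left, each column from top to bottom, is a Yamanouchi word; (ii) the weight $(T[1],\dots,T[2n])$ is an even partition; (iii) whenever $T(i,j)=2k+1$ with $k\in\mathbb{Z}_{\ge0}$, one has $i\le n+k$. Strip decomposition of $T\in LRS_{2n}(\lambda/\mu)$ of weight $\nu$: put $\mu^{(0)}=\lambda$; for $k=1,\dots,\nu_1$, let $J_k$ consist of, for each $i=1,\dots,\nu^t_k$, the rightmost cell of $D(\mu^{(k-1)}/\mu)$ whose entry in $T$ is $i$, and let $D(\mu^{(k)})=D(\mu^{(k-1)})\setminus J_k$. Then $\lambda=\mu^{(0)}\supseteq\mu^{(1)}\supseteq\cdots\supseteq\mu^{(\nu_1)}=\mu$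 with each $J_k=\mu^{(k-1)}/\mu^{(k)}$ a vertical strip. $\widetilde{Rec}_{2n}(\lambda/\mu)$, for $\lambda\in Par_{\le2n}$, $\mu\in Par_{\le n}$, $\mu\subseteq\lambda$: the set of fillings $Q$ of $D(\lambda/\mu)$ by positive integers such that (R1) entries strictly decrease along rows from left to right; (R2) entries weakly decrease down columns; (R3) $Q[k]$ is even for every $k>0$; (R4) for every $k>0$, $Q[k]\ge 2(\ell(\mu^{(k-1)})-n)$, where $D(\mu^{(k-1)})=D(\mu)\cup\{(i,j)\in D(\lambda/\mu):Q(i,j)\ge k\}$; (R5) for all $r,k>0$, $Q_{\le r}[k+1]\le Q_{\le r}[k]$, where $Q_{\le r}[k]$ is the number of entries $k$ of $Q$ in rows $1,\dots,r$. *)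

theory Defs
  imports Main "HOL-Library.FuncSet" "HOL-Library.Disjoint_Sets"
begin

text \<open>
  Partitions are functions on \<open>nat\<close> whose value at \<open>i \<ge> 1\<close> is the \<open>i\<close>-th part; the value at the
  dummy index 0 is normalised to 0, so that distinct functions are distinct partitions. Rows,
  columns and entries are numbered from 1, with \<open>(i, j)\<close> the cell in row \<open>i\<close> and column \<open>j\<close>.
\<close>

definition is_partition :: "(nat \<Rightarrow> nat) \<Rightarrow> bool" where
  "is_partition \<gamma> \<longleftrightarrow>
     \<gamma> 0 = 0 \<and> (\<forall>i\<ge>1. \<gamma> (Suc i) \<le> \<gamma> i) \<and> finite {i. \<gamma> i \<noteq> 0}"

definition part_length :: "(nat \<Rightarrow> nat) \<Rightarrow> nat" where
  "part_length \<gamma> = card {i. \<gamma> i \<noteq> 0}"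

definition Par_le :: "nat \<Rightarrow> (nat \<Rightarrow> nat) set" where
  "Par_le m = {\<gamma>. is_partition \<gamma> \<and> part_length \<gamma> \<le> m}"

definition even_partition :: "(nat \<Rightarrow> nat) \<Rightarrow> bool" where
  "even_partition \<gamma> \<longleftrightarrow> is_partition \<gamma> \<and> (\<forall>i\<ge>1. \<gamma> (2 * i - 1) = \<gamma> (2 * i))"

definition diagram :: "(nat \<Rightarrow> nat) \<Rightarrow> (nat \<times> nat) set" where
  "diagram \<gamma> = {(i, j). 1 \<le> i \<and> i \<le> part_length \<gamma> \<and> 1 \<le> j \<and> j \<le> \<gamma> i}"

definition skew :: "(nat \<Rightarrow> nat) \<Rightarrow> (nat \<Rightarrow> nat) \<Rightarrow> (nat \<times> nat) set" where
  "skew lam mu = diagram lam - diagram mu"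

definition conjugate :: "(nat \<Rightarrow> nat) \<Rightarrow> nat \<Rightarrow> nat" where
  "conjugate \<gamma> j = card {i. (i, j) \<in> diagram \<gamma>}"

text \<open>Left inverse of \<^const>\<open>diagram\<close> on partitions, see \<open>shape_of_diagram\<close> below.\<close>

definition shape_of :: "(nat \<times> nat) set \<Rightarrow> nat \<Rightarrow> nat" where
  "shape_of S i = card {j. (i, j) \<in> S}"

definition is_vertical_strip :: "(nat \<times> nat) set \<Rightarrow> bool" where
  "is_vertical_strip J \<longleftrightarrow>
     (\<exists>\<alpha> \<beta>. is_partition \<alpha> \<and> is_partition \<beta> \<and> diagram \<beta> \<subseteq> diagram \<alpha> \<and> J = skew \<alpha> \<beta>) \<and>
     (\<forall>i. card {j. (i, j) \<in> J} \<le> 1)"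

definition weight :: "(nat \<times> nat) set \<Rightarrow> (nat \<times> nat \<Rightarrow> nat) \<Rightarrow> nat \<Rightarrow> nat" where
  "weight S U k = card {c \<in> S. U c = k}"

text \<open>
  Fillings of a shape are extensional functions, so that equality of functions is equality of
  tableaux.
\<close>

definition SST :: "nat \<Rightarrow> (nat \<Rightarrow> nat) \<Rightarrow> (nat \<Rightarrow> nat) \<Rightarrow> (nat \<times> nat \<Rightarrow> nat) set" where
  "SST m lam mu = {T \<in> skew lam mu \<rightarrow>\<^sub>E {1..m}.
     (\<forall>i j j'. (i, j) \<in> skew lam mu \<and> (i, j') \<in> skew lam mu \<and> j < j' \<longrightarrow> T (i, j) \<le> T (i, j')) \<and>
     (\<forall>i i' j. (i, j) \<in> skew lam mu \<and> (i', j) \<in> skew lam mu \<and> i < i' \<longrightarrow> T (i, j) < T (i', j))}"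

definition column_word ::
  "(nat \<Rightarrow> nat) \<Rightarrow> (nat \<Rightarrow> nat) \<Rightarrow> (nat \<times> nat \<Rightarrow> nat) \<Rightarrow> nat list" where
  "column_word lam mu T =
     concat (map (\<lambda>j. map (\<lambda>i. T (i, j))
                        (filter (\<lambda>i. (i, j) \<in> skew lam mu) [1..<Suc (part_length lam)]))
                 (rev [1..<Suc (lam 1)]))"

definition yamanouchi :: "nat list \<Rightarrow> bool" where
  "yamanouchi w \<longleftrightarrow> (\<forall>k\<le>length w. is_partition (count_list (take k w)))"

text \<open>\<open>LRS n\<close> and \<open>Rec_tilde n\<close> carry the index \<open>n\<close> where the usual notation has \<open>2n\<close>.\<close>

definition LRS :: "nat \<Rightarrow> (nat \<Rightarrow> nat) \<Rightarrow> (nat \<Rightarrow> nat) \<Rightarrow> (nat \<times> nat \<Rightarrow> nat) set" where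
  "LRS n lam mu = {T \<in> SST (2 * n) lam mu.
     yamanouchi (column_word lam mu T) \<and>
     even_partition (weight (skew lam mu) T) \<and>
     (\<forall>i j k. (i, j) \<in> skew lam mu \<and> T (i, j) = 2 * k + 1 \<longrightarrow> i \<le> n + k)}"

text \<open>
  The cells which, for some \<open>i \<in> {1..h}\<close>, are a rightmost cell with entry \<open>i\<close> in the set \<open>X\<close>; such
  a cell is unique for given \<open>i\<close>, as the entries of a semistandard tableau in a column are distinct.
\<close>

definition rightmost_cells ::
  "(nat \<times> nat \<Rightarrow> nat) \<Rightarrow> (nat \<times> nat) set \<Rightarrow> nat \<Rightarrow> (nat \<times> nat) set" where
  "rightmost_cells T X h =
     {c \<in> X. T c \<in> {1..h} \<and> (\<forall>d\<in>X. T d = T c \<longrightarrow> snd d \<le> snd c)}"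

text \<open>\<open>stage lam mu T k\<close> is the diagram \<open>D(\<mu>\<^sup>(\<^sup>k\<^sup>))\<close>, and \<open>strip lam mu T k\<close> is \<open>J\<^sub>k\<close> for \<open>k \<ge> 1\<close>.\<close>

primrec stage ::
  "(nat \<Rightarrow> nat) \<Rightarrow> (nat \<Rightarrow> nat) \<Rightarrow> (nat \<times> nat \<Rightarrow> nat) \<Rightarrow> nat \<Rightarrow> (nat \<times> nat) set" where
  "stage lam mu T 0 = diagram lam"
| "stage lam mu T (Suc k) = stage lam mu T k -
     rightmost_cells T (stage lam mu T k - diagram mu)
       (conjugate (weight (skew lam mu) T) (Suc k))"

definition strip ::
  "(nat \<Rightarrow> nat) \<Rightarrow> (nat \<Rightarrow> nat) \<Rightarrow> (nat \<times> nat \<Rightarrow> nat) \<Rightarrow> nat \<Rightarrow> (nat \<times> nat) set" where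
  "strip lam mu T k =
     rightmost_cells T (stage lam mu T (k - 1) - diagram mu)
       (conjugate (weight (skew lam mu) T) k)"

definition lozenge ::
  "(nat \<Rightarrow> nat) \<Rightarrow> (nat \<Rightarrow> nat) \<Rightarrow> (nat \<times> nat \<Rightarrow> nat) \<Rightarrow> (nat \<times> nat \<Rightarrow> nat)" where
  "lozenge lam mu T =
     (\<lambda>c\<in>skew lam mu. THE k. k \<in> {1..weight (skew lam mu) T 1} \<and> c \<in> strip lam mu T k)"

definition Rec_tilde :: "nat \<Rightarrow> (nat \<Rightarrow> nat) \<Rightarrow> (nat \<Rightarrow> nat) \<Rightarrow> (nat \<times> nat \<Rightarrow> nat) set" where
  "Rec_tilde n lam mu = {Q \<in> skew lam mu \<rightarrow>\<^sub>E {1..}.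
     (\<forall>i j j'. (i, j) \<in> skew lam mu \<and> (i, j') \<in> skew lam mu \<and> j < j' \<longrightarrow> Q (i, j') < Q (i, j)) \<and>
     (\<forall>i i' j. (i, j) \<in> skew lam mu \<and> (i', j) \<in> skew lam mu \<and> i < i' \<longrightarrow> Q (i', j) \<le> Q (i, j)) \<and>
     (\<forall>k>0. even (weight (skew lam mu) Q k)) \<and>
     (\<forall>k>0. int (weight (skew lam mu) Q k) \<ge>
        2 * (int (part_length (shape_of (diagram mu \<union> {c \<in> skew lam mu. Q c \<ge> k}))) - int n)) \<and>
     (\<forall>r>0. \<forall>k>0. weight {c \<in> skew lam mu. fst c \<le> r} Q (k + 1)
                   \<le> weight {c \<in> skew lam mu. fst c \<le> r} Q k)}"

lemma partition_antimono:
  assumes "is_partition \<gamma>" "1 \<le> i" "i \<le> i'"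
  shows "\<gamma> i' \<le> \<gamma> i"
  using assms(3)
proof (induction i' rule: dec_induct)
  case (step m)
  then show ?case
    using assms(1,2) le_trans[of "\<gamma> (Suc m)" "\<gamma> m" "\<gamma> i"] by (auto simp: is_partition_def)
qed simp

lemma partition_support:
  assumes "is_partition \<gamma>"
  shows "{i. \<gamma> i \<noteq> 0} = {1..part_length \<gamma>}"
proof (cases "{i. \<gamma> i \<noteq> 0} = {}")
  case True
  then show ?thesis by (simp add: part_length_def)
next
  case False
  define m where "m = Max {i. \<gamma> i \<noteq> 0}"
  have fin: "finite {i. \<gamma> i \<noteq> 0}" and z: "\<gamma> 0 = 0"
    using assms by (auto simp: is_partition_def)
  have m: "\<gamma> m \<noteq> 0" using Max_in[OF fin False] by (simp add: m_def)
  have "{i. \<gamma> i \<noteq> 0} = {1..m}"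
  proof (intro set_eqI iffI)
    fix i assume i: "i \<in> {i. \<gamma> i \<noteq> 0}"
    then have "i \<noteq> 0" using z by (cases i) auto
    then show "i \<in> {1..m}" using i Max_ge[OF fin i] by (simp add: m_def)
  next
    fix i assume "i \<in> {1..m}"
    then show "i \<in> {i. \<gamma> i \<noteq> 0}" using partition_antimono[OF assms, of i m] m by auto
  qed
  then show ?thesis by (simp add: part_length_def)
qed

lemma shape_of_diagram:
  assumes "is_partition \<gamma>"
  shows "shape_of (diagram \<gamma>) = \<gamma>"
proof
  fix i
  have "{j. (i, j) \<in> diagram \<gamma>} = {1..\<gamma> i}"
  proof (cases "\<gamma> i = 0")
    case True
    then show ?thesis by (auto simp: diagram_def)
  next
    case False
    then have "i \<in> {1..part_length \<gamma>}" using partition_support[OF assms] by blast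
    then show ?thesis by (auto simp: diagram_def)
  qed
  then show "shape_of (diagram \<gamma>) i = \<gamma> i" by (simp add: shape_of_def)
qed

end

theory Submission
  imports Defs
begin

text \<open>
  For a Littlewood--Richardson tableau \<open>T\<close>, the entry of \<open>\<lozenge>T\<close> in a cell \<open>c\<close> is the rank of \<open>c\<close>,
  counted from the right, among the cells with the same entry of \<open>T\<close>; conversely \<open>T c\<close> is the rank
  of \<open>c\<close>, counted from the top, among the cells with the same entry of \<open>\<lozenge>T\<close>. The axioms for the two
  kinds of fillings (monotonicity in rows and columns plus a lattice condition, on columns \<open>\<ge> j\<close>
  and on rows \<open>\<le> r\<close> respectively) are exchanged by the reflection \<open>(i, j) \<mapsto> (-j, -i)\<close>. Hence one
  argument, applied in both coordinate systems, shows that the two ranking operations preserve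
  the axioms and are mutually inverse. The cell \<open>c\<close> is sent to \<open>(T c, \<lozenge>T c)\<close> bijectively onto the
  diagram of the weight, so the two weights are conjugate and the evenness conditions agree.
\<close>

section \<open>Ranking cells in an abstract coordinate grid\<close>

text \<open>
  With \<open>(x, y) = (row, column)\<close> these are the conditions (R1), (R2) and (R5); with
  \<open>(x, y) = (-column, -row)\<close> they describe Littlewood--Richardson tableaux.
\<close>

definition admissible ::
  "(nat \<times> nat) set \<Rightarrow> (nat \<times> nat \<Rightarrow> int) \<Rightarrow> (nat \<times> nat \<Rightarrow> int) \<Rightarrow> (nat \<times> nat \<Rightarrow> nat) \<Rightarrow> bool" where
  "admissible S x y F \<longleftrightarrow>
     (\<forall>c\<in>S. 1 \<le> F c) \<and>
     (\<forall>c\<in>S. \<forall>d\<in>S. x c = x d \<and> y c < y d \<longrightarrow> F d < F c) \<and>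
     (\<forall>c\<in>S. \<forall>d\<in>S. y c = y d \<and> x c < x d \<longrightarrow> F d \<le> F c) \<and>
     (\<forall>r k. 1 \<le> k \<longrightarrow> weight {c\<in>S. x c \<le> r} F (Suc k) \<le> weight {c\<in>S. x c \<le> r} F k)"

text \<open>A cell counts itself, so ranks on \<open>S\<close> start at 1. A fibre of an admissible
  filling has at most one cell on each line of constant \<open>x\<close> (\<open>fibre_inj\<close>),
  so the weak inequality creates no ties.\<close>

definition companion ::
  "(nat \<times> nat) set \<Rightarrow> (nat \<times> nat \<Rightarrow> int) \<Rightarrow> (nat \<times> nat \<Rightarrow> nat) \<Rightarrow> nat \<times> nat \<Rightarrow> nat" where
  "companion S x F c = card {d\<in>S. F d = F c \<and> x d \<le> x c}"

text \<open>\<open>corner\<close> is all that the argument retains of the skew shape. The reflection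
  \<open>(x, y) -> (-y, -x)\<close> exchanges the roles of \<open>c\<close> and \<open>d\<close> but
  keeps the corner \<open>e\<close>, which makes the axioms self-dual; integer coordinates leave
  room for the signs.\<close>

locale grid =
  fixes S :: "(nat \<times> nat) set" and x y :: "nat \<times> nat \<Rightarrow> int"
  assumes finite_S: "finite S"
    and coords_inj: "\<lbrakk>c \<in> S; d \<in> S; x c = x d; y c = y d\<rbrakk> \<Longrightarrow> c = d"
    and corner: "\<lbrakk>c \<in> S; d \<in> S; x c \<le> x d; y c \<le> y d\<rbrakk> \<Longrightarrow> \<exists>e\<in>S. x e = x c \<and> y e = y d"
begin

lemma dual_grid: "grid S (\<lambda>c. - y c) (\<lambda>c. - x c)"
proof
  fix c d
  assume "c \<in> S" "d \<in> S" "- y c \<le> - y d" "- x c \<le> - x d"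
  then show "\<exists>e\<in>S. - y e = - y c \<and> - x e = - x d"
    using corner[of d c] by auto
qed (use finite_S coords_inj in auto)

end

locale admissible_filling = grid +
  fixes F :: "nat \<times> nat \<Rightarrow> nat"
  assumes adm: "admissible S x y F"
begin

abbreviation G :: "nat \<times> nat \<Rightarrow> nat" where
  "G \<equiv> companion S x F"

lemma F_pos: "c \<in> S \<Longrightarrow> 1 \<le> F c"
  and F_row: "\<lbrakk>c \<in> S; d \<in> S; x c = x d; y c < y d\<rbrakk> \<Longrightarrow> F d < F c"
  and F_col: "\<lbrakk>c \<in> S; d \<in> S; y c = y d; x c < x d\<rbrakk> \<Longrightarrow> F d \<le> F c"
  and F_lattice: "1 \<le> k \<Longrightarrow> weight {c\<in>S. x c \<le> r} F (Suc k) \<le> weight {c\<in>S. x c \<le> r} F k"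
  using adm unfolding admissible_def by blast+

lemma F_lattice_le:
  assumes "1 \<le> k" "k \<le> l"
  shows "weight {c\<in>S. x c \<le> r} F l \<le> weight {c\<in>S. x c \<le> r} F k"
  using assms(2)
proof (induction l rule: dec_induct)
  case (step m)
  then show ?case using F_lattice[of m r] assms(1) by linarith
qed simp

lemma weight_F_le:
  assumes "1 \<le> k" "k \<le> l"
  shows "weight S F l \<le> weight S F k"
proof (cases "S = {}")
  case False
  \<comment> \<open>The half-plane bounded by the largest \<open>x\<close> is everything, so the
    lattice condition also compares total weights.\<close>
  have "{c\<in>S. x c \<le> Max (x ` S)} = S"
    using finite_S by auto
  then show ?thesis using F_lattice_le[OF assms, of "Max (x ` S)"] by simp
qed (simp add: weight_def)

text \<open>Walk from \<open>c\<close> to the corner along constant \<open>x\<close>, then on to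
  \<open>d\<close> along constant \<open>y\<close>.\<close>

lemma F_antimono:
  assumes "c \<in> S" "d \<in> S" "x c \<le> x d" "y c \<le> y d"
  shows "F d \<le> F c"
proof -
  obtain e where e: "e \<in> S" "x e = x c" "y e = y d"
    using corner[OF assms] by blast
  have "F e \<le> F c"
    using F_row[of c e] coords_inj[of c e] e assms by (cases "y c = y d") auto
  moreover have "F d \<le> F e"
    using F_col[of e d] coords_inj[of d e] e assms by (cases "x c = x d") auto
  ultimately show ?thesis by simp
qed

text \<open>Otherwise the corner \<open>e\<close> would give \<open>F d \<le> F e < F c\<close>. So
  a fibre moves weakly towards smaller \<open>y\<close> as \<open>x\<close> grows.\<close>

lemma fibre_y:
  assumes "c \<in> S" "d \<in> S" "F c = F d" "x c < x d"
  shows "y d \<le> y c"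
proof (rule ccontr)
  assume "\<not> y d \<le> y c"
  then obtain e where e: "e \<in> S" "x e = x c" "y e = y d"
    using corner[of c d] assms by auto
  have "F d \<le> F e" using F_col[of e d] e assms by auto
  moreover have "F e < F c" using F_row[of c e] e assms \<open>\<not> y d \<le> y c\<close> by auto
  ultimately show False using assms by simp
qed

lemma fibre_inj:
  assumes "c \<in> S" "d \<in> S" "F c = F d" "x c = x d"
  shows "c = d"
  using F_row[of c d] F_row[of d c] coords_inj[of c d] assms
  by (cases "y c" "y d" rule: linorder_cases) auto

text \<open>Reads a rank as a count in a half-plane, the form to which the lattice condition
  applies.\<close>

lemma G_weight: "G c = weight {d\<in>S. x d \<le> x c} F (F c)"
  unfolding companion_def weight_def by (rule arg_cong[where f = card]) auto

lemma weight_less: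
  assumes "d \<in> S" "r < x d" "F d = k"
  shows "weight {c\<in>S. x c \<le> r} F k < weight {c\<in>S. x c \<le> x d} F k"
  unfolding weight_def
proof (rule psubset_card_mono)
  show "{c \<in> {c \<in> S. x c \<le> r}. F c = k} \<subset> {c \<in> {c \<in> S. x c \<le> x d}. F c = k}"
    using assms by force
qed (use finite_S in auto)

lemma G_less:
  assumes "c \<in> S" "d \<in> S" "F c = F d" "x c < x d"
  shows "G c < G d"
  using weight_less[of d "x c"] assms by (simp add: G_weight)

lemma G_inj:
  assumes "c \<in> S" "d \<in> S" "F c = F d" "G c = G d"
  shows "c = d"
  using G_less[of c d] G_less[of d c] fibre_inj[of c d] assms
  by (cases "x c" "x d" rule: linorder_cases) auto

lemma G_pos: "c \<in> S \<Longrightarrow> 1 \<le> G c"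
proof -
  assume "c \<in> S"
  then have "{c} \<subseteq> {d\<in>S. F d = F c \<and> x d \<le> x c}" by simp
  then show ?thesis
    unfolding companion_def using finite_S card_mono[of "{d\<in>S. F d = F c \<and> x d \<le> x c}" "{c}"]
    by simp
qed

text \<open>Ranks in a fibre are distinct and bounded by its size, so by counting they exhaust the
  interval.\<close>

lemma G_bij: "bij_betw G {c\<in>S. F c = k} {1..weight S F k}"
proof -
  have inj: "inj_on G {c\<in>S. F c = k}"
    by (rule inj_onI) (simp add: G_inj)
  have "G c \<le> weight S F k" if "c \<in> S" "F c = k" for c
    unfolding companion_def weight_def using finite_S that by (auto intro!: card_mono)
  then have "G ` {c\<in>S. F c = k} \<subseteq> {1..weight S F k}"
    using G_pos by auto
  moreover have "card (G ` {c\<in>S. F c = k}) = card {1..weight S F k}"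
    using inj by (simp add: card_image weight_def)
  ultimately show ?thesis
    using inj by (simp add: bij_betw_def card_subset_eq)
qed

lemma G_surj:
  assumes "1 \<le> i" "i \<le> weight S F k"
  obtains c where "c \<in> S" "F c = k" "G c = i"
proof -
  have "i \<in> G ` {c\<in>S. F c = k}"
    using G_bij[of k] assms by (auto simp: bij_betw_def)
  then show thesis using that by auto
qed

lemma G_le_weight: "c \<in> S \<Longrightarrow> G c \<le> weight S F (F c)"
  using G_bij[of "F c"] by (force simp: bij_betw_def)

text \<open>If \<open>x d < x c\<close>, the half-plane up to \<open>x d\<close> misses
  \<open>c\<close> and so holds fewer than \<open>G c = G d\<close> cells with value
  \<open>F c\<close>, but \<open>G d\<close> cells with the larger value \<open>F d\<close>, against
  the lattice condition. Hence \<open>x c \<le> x d\<close>, and \<open>y c \<le> y d\<close> would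
  contradict \<open>F_antimono\<close>.\<close>

lemma G_fibre_y:
  assumes "c \<in> S" "d \<in> S" "G c = G d" "F c < F d"
  shows "y d < y c"
proof -
  have "x c \<le> x d"
  proof (rule ccontr)
    assume "\<not> x c \<le> x d"
    then have "weight {e\<in>S. x e \<le> x d} F (F c) < G c"
      using weight_less[of c "x d"] assms by (simp add: G_weight)
    moreover have "weight {e\<in>S. x e \<le> x d} F (F d) \<le> weight {e\<in>S. x e \<le> x d} F (F c)"
      using F_lattice_le F_pos assms by simp
    ultimately show False using assms G_weight[of d] by simp
  qed
  then show ?thesis using F_antimono[of c d] assms by force
qed

text \<open>The cells of rank \<open>G c\<close> on the side \<open>y \<ge> y c\<close> carry each
  value from 1 to \<open>F c\<close> exactly once. Every \<open>k \<le> F c\<close> occurs among the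
  cells of that rank because its fibre is at least as large as that of \<open>F c\<close>;
  \<open>G_fibre_y\<close> decides on which side of \<open>c\<close> the cell lies.\<close>

lemma companion_companion:
  assumes "c \<in> S"
  shows "companion S (\<lambda>c. - y c) G c = F c"
proof -
  let ?A = "{d\<in>S. G d = G c \<and> - y d \<le> - y c}"
  have "inj_on F ?A"
    by (rule inj_onI) (simp add: G_inj)
  moreover have "F ` ?A = {1..F c}"
  proof (intro subset_antisym subsetI)
    fix k assume "k \<in> F ` ?A"
    then obtain d where d: "d \<in> S" "G d = G c" "y c \<le> y d" "F d = k" by auto
    then have "\<not> F c < F d" using G_fibre_y[of c d] assms by auto
    then show "k \<in> {1..F c}" using F_pos[of d] d by simp
  next
    fix k assume k: "k \<in> {1..F c}"
    then have "G c \<le> weight S F k"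
      using G_le_weight[OF assms] weight_F_le[of k "F c"] by simp
    then obtain d where d: "d \<in> S" "F d = k" "G d = G c"
      using G_surj G_pos[OF assms] by metis
    have "y c \<le> y d"
    proof (cases "k = F c")
      case True
      then have "c = d" using G_inj[OF assms d(1)] d by simp
      then show ?thesis by simp
    next
      case False
      then show ?thesis using G_fibre_y[OF d(1) assms] d k by simp
    qed
    then show "k \<in> F ` ?A" using d by (intro image_eqI[of _ _ d]) auto
  qed
  ultimately have "card ?A = card {1..F c}"
    using card_image[of F ?A] by simp
  then show ?thesis by (simp add: companion_def)
qed

text \<open>Monotonicity of \<open>G\<close> comes from the lattice condition of \<open>F\<close>,
  since equal or nested half-planes are compared for two ordered values. The lattice condition of
  \<open>G\<close> comes from the shape of the fibres of \<open>F\<close>: stepping back one rank in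
  a fibre does not decrease \<open>y\<close>.\<close>

lemma companion_admissible: "admissible S (\<lambda>c. - y c) (\<lambda>c. - x c) G"
  unfolding admissible_def
proof (intro conjI ballI allI impI)
  fix c d assume c: "c \<in> S" and d: "d \<in> S" and xy: "- y c = - y d \<and> - x c < - x d"
  have "G d \<le> weight {e\<in>S. x e \<le> x d} F (F c)"
    using F_lattice_le F_col[of d c] F_pos c d xy by (simp add: G_weight)
  also have "\<dots> < G c"
    using weight_less c xy by (simp add: G_weight)
  finally show "G d < G c" .
next
  fix c d assume c: "c \<in> S" and d: "d \<in> S" and xy: "- x c = - x d \<and> - y c < - y d"
  then show "G d \<le> G c"
    using F_lattice_le F_row[of d c] F_pos by (simp add: G_weight)
next
  fix r and i :: nat assume i: "1 \<le> i"
  let ?A = "\<lambda>i. {c \<in> {c\<in>S. - y c \<le> r}. G c = i}"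
  have inj: "inj_on F (?A i)" for i
    by (rule inj_onI) (simp add: G_inj)
  \<comment> \<open>On cells of a fixed rank \<open>F\<close> is injective, so comparing the sets of
    values compares the counts.\<close>
  have "F ` ?A (Suc i) \<subseteq> F ` ?A i"
  proof
    fix k assume "k \<in> F ` ?A (Suc i)"
    then obtain c where c: "c \<in> S" "- y c \<le> r" "G c = Suc i" "F c = k" by auto
    then obtain d where d: "d \<in> S" "F d = k" "G d = i"
      using G_surj[of i k] G_le_weight[of c] i by auto
    then have "x d < x c"
      using G_less[of c d] G_inj[of c d] fibre_inj[of c d] c
      by (cases "x c" "x d" rule: linorder_cases) auto
    then show "k \<in> F ` ?A i"
      using fibre_y[of d c] c d by (intro image_eqI[of _ _ d]) auto
  qed
  then have "card (F ` ?A (Suc i)) \<le> card (F ` ?A i)"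
    using finite_S by (intro card_mono) auto
  then show "weight {c\<in>S. - y c \<le> r} G (Suc i) \<le> weight {c\<in>S. - y c \<le> r} G i"
    using inj by (simp add: weight_def card_image)
qed (use G_pos in simp)

lemma dual: "admissible_filling S (\<lambda>c. - y c) (\<lambda>c. - x c) G"
  using dual_grid companion_admissible
  by (simp add: admissible_filling_def admissible_filling_axioms_def)

text \<open>Both sides say that some cell has \<open>F c = k\<close> and \<open>G c = i\<close>;
  hence the two weights are conjugate.\<close>

lemma weight_G_iff:
  assumes "1 \<le> i" "1 \<le> k"
  shows "i \<le> weight S F k \<longleftrightarrow> k \<le> weight S G i"
proof
  assume "i \<le> weight S F k"
  then obtain c where c: "c \<in> S" "F c = k" "G c = i" using G_surj assms by metis
  interpret D: admissible_filling S "\<lambda>c. - y c" "\<lambda>c. - x c" G by (rule dual)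
  show "k \<le> weight S G i"
    using D.G_le_weight[OF c(1)] companion_companion[OF c(1)] c by simp
next
  assume k: "k \<le> weight S G i"
  interpret D: admissible_filling S "\<lambda>c. - y c" "\<lambda>c. - x c" G by (rule dual)
  obtain c where c: "c \<in> S" "G c = i" "D.G c = k" using D.G_surj k assms by metis
  show "i \<le> weight S F k"
    using G_le_weight[OF c(1)] companion_companion[OF c(1)] c by simp
qed

end


section \<open>Congruence rules and diagrams of partitions\<close>

lemma admissible_cong:
  assumes "\<And>c. c \<in> S \<Longrightarrow> F c = F' c"
  shows "admissible S x y F \<longleftrightarrow> admissible S x y F'"
proof -
  have "weight {c\<in>S. x c \<le> r} F k = weight {c\<in>S. x c \<le> r} F' k" for r k
    unfolding weight_def using assms by (intro arg_cong[where f = card]) auto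
  then show ?thesis using assms by (auto simp: admissible_def)
qed

lemma companion_cong:
  assumes "\<And>c. c \<in> S \<Longrightarrow> F c = F' c" "c \<in> S"
  shows "companion S x F c = companion S x F' c"
  unfolding companion_def using assms by (intro arg_cong[where f = card]) auto

lemma weight_cong:
  assumes "\<And>c. c \<in> S \<Longrightarrow> F c = F' c"
  shows "weight S F = weight S F'"
  unfolding weight_def using assms by (intro ext arg_cong[where f = card]) auto

lemma mem_diagram_iff:
  assumes "is_partition \<gamma>"
  shows "(i, j) \<in> diagram \<gamma> \<longleftrightarrow> 1 \<le> i \<and> 1 \<le> j \<and> j \<le> \<gamma> i"
proof -
  have "\<gamma> i \<noteq> 0 \<longleftrightarrow> 1 \<le> i \<and> i \<le> part_length \<gamma>"
    using partition_support[OF assms] by (auto simp: set_eq_iff)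
  then show ?thesis by (auto simp: diagram_def)
qed

lemma conjugate_eq_card:
  assumes "is_partition \<gamma>" "1 \<le> j"
  shows "conjugate \<gamma> j = card {i. 1 \<le> i \<and> j \<le> \<gamma> i}"
  using assms by (simp add: conjugate_def mem_diagram_iff)

text \<open>Each row of such a set is an initial segment, which \<open>shape_of\<close> measures.
  This will turn superlevel sets of a filling into partitions.\<close>

lemma down_closed_diagram:
  assumes fin: "finite D"
    and pos: "\<And>i j. (i, j) \<in> D \<Longrightarrow> 1 \<le> i \<and> 1 \<le> j"
    and down: "\<And>i j i' j'. \<lbrakk>(i, j) \<in> D; 1 \<le> i'; i' \<le> i; 1 \<le> j'; j' \<le> j\<rbrakk> \<Longrightarrow> (i', j') \<in> D"
  shows "is_partition (shape_of D)" and "diagram (shape_of D) = D"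
proof -
  have finrow: "finite {j. (i, j) \<in> D}" for i
    using finite_vimageI[OF fin, of "Pair i"] by (simp add: vimage_def inj_on_def)
  have row: "{j. (i, j) \<in> D} = {1..shape_of D i}" for i
  proof (cases "{j. (i, j) \<in> D} = {}")
    case True
    then show ?thesis by (simp add: shape_of_def)
  next
    case False
    define m where "m = Max {j. (i, j) \<in> D}"
    have m: "(i, m) \<in> D" using Max_in[OF finrow False] by (simp add: m_def)
    have "{j. (i, j) \<in> D} = {1..m}"
    proof (intro subset_antisym subsetI)
      fix j assume "j \<in> {j. (i, j) \<in> D}"
      then show "j \<in> {1..m}" using pos Max_ge[OF finrow, of j i] by (auto simp: m_def)
    next
      fix j assume "j \<in> {1..m}"
      then show "j \<in> {j. (i, j) \<in> D}" using down[OF m] pos[OF m] by simp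
    qed
    then show ?thesis by (simp add: shape_of_def)
  qed
  then have mem: "(i, j) \<in> D \<longleftrightarrow> 1 \<le> j \<and> j \<le> shape_of D i" for i j
    by (auto simp: set_eq_iff)
  show part: "is_partition (shape_of D)"
    unfolding is_partition_def
  proof (intro conjI allI impI)
    show "shape_of D 0 = 0"
      using mem[of 0 "shape_of D 0"] pos[of 0 "shape_of D 0"] by (cases "shape_of D 0 = 0") auto
  next
    fix i :: nat assume "1 \<le> i"
    then show "shape_of D (Suc i) \<le> shape_of D i"
      using mem[of "Suc i" "shape_of D (Suc i)"] mem[of i "shape_of D (Suc i)"]
        down[of "Suc i" "shape_of D (Suc i)" i "shape_of D (Suc i)"]
      by (cases "shape_of D (Suc i) = 0") auto
  next
    have "{i. shape_of D i \<noteq> 0} \<subseteq> fst ` D"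
    proof
      fix i assume "i \<in> {i. shape_of D i \<noteq> 0}"
      then have "(i, 1) \<in> D" using mem by simp
      then show "i \<in> fst ` D" by force
    qed
    then show "finite {i. shape_of D i \<noteq> 0}" using fin finite_subset by blast
  qed
  show "diagram (shape_of D) = D"
    using mem pos by (auto simp: mem_diagram_iff[OF part])
qed

section \<open>The reading order of columns from right to left\<close>

definition reading_before :: "nat \<times> nat \<Rightarrow> nat \<times> nat \<Rightarrow> bool" where
  "reading_before c d \<longleftrightarrow> snd d < snd c \<or> snd d = snd c \<and> fst c < fst d"

lemma sorted_wrt_column_cells:
  assumes "sorted_wrt (>) js" "sorted_wrt (<) is"
  shows "sorted_wrt reading_before (concat (map (\<lambda>j. map (\<lambda>i. (i, j)) (filter (p j) is)) js))"
  using assms(1)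
proof (induction js)
  case (Cons j js)
  have "sorted_wrt (<) (filter (p j) is)"
    using assms(2) by (rule sorted_wrt_filter)
  then show ?case
    using Cons by (auto simp: sorted_wrt_append sorted_wrt_map reading_before_def)
qed simp

lemma distinct_reading: "sorted_wrt reading_before xs \<Longrightarrow> distinct xs"
  by (induction xs) (auto simp: reading_before_def)

text \<open>A condition inherited by earlier elements cuts out a prefix; it is applied to the cells
  weakly to the right of a given column.\<close>

lemma takeWhile_eq_filter:
  assumes "sorted_wrt R xs" "\<And>a b. R a b \<Longrightarrow> P b \<Longrightarrow> P a"
  shows "takeWhile P xs = filter P xs"
  using assms(1)
proof (induction xs)
  case (Cons a xs)
  then have "\<not> P a \<Longrightarrow> filter P xs = []"
    using assms(2) by (auto simp: filter_empty_conv)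
  then show ?case using Cons by simp
qed simp

lemma count_list_map_distinct:
  assumes "distinct xs"
  shows "count_list (map T xs) i = card {c \<in> set xs. T c = i}"
proof -
  have "count_list (map T xs) i = length (filter (\<lambda>c. i = T c) xs)"
    by (induction xs) auto
  also have "\<dots> = card {c \<in> set xs. T c = i}"
    using distinct_length_filter[OF assms] by (auto intro: arg_cong[where f = card])
  finally show ?thesis .
qed

lemma is_partition_count_list:
  "is_partition (count_list w) \<longleftrightarrow>
     0 \<notin> set w \<and> (\<forall>i\<ge>1. count_list w (Suc i) \<le> count_list w i)"
proof -
  have "{i. count_list w i \<noteq> 0} = set w" by (auto simp: count_list_0_iff)
  then show ?thesis by (simp add: is_partition_def count_list_0_iff)
qed

abbreviation row :: "nat \<times> nat \<Rightarrow> int" where "row c \<equiv> int (fst c)"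
abbreviation col :: "nat \<times> nat \<Rightarrow> int" where "col c \<equiv> int (snd c)"

section \<open>Both kinds of tableaux as admissible fillings of a skew shape\<close>

locale skew_shape =
  fixes lam mu :: "nat \<Rightarrow> nat" and n :: nat
  assumes lam_Par: "lam \<in> Par_le (2 * n)" and mu_Par: "mu \<in> Par_le n"
    and mu_lam: "diagram mu \<subseteq> diagram lam"
begin

abbreviation S :: "(nat \<times> nat) set" where "S \<equiv> skew lam mu"

lemma lam_partition: "is_partition lam" and lam_length: "part_length lam \<le> 2 * n"
  and mu_partition: "is_partition mu" and mu_length: "part_length mu \<le> n"
  using lam_Par mu_Par by (auto simp: Par_le_def)

lemma mem_skew: "(i, j) \<in> S \<longleftrightarrow> 1 \<le> i \<and> mu i < j \<and> j \<le> lam i"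
  by (auto simp: skew_def mem_diagram_iff[OF lam_partition] mem_diagram_iff[OF mu_partition])

lemma mu_zero: "n < i \<Longrightarrow> mu i = 0"
proof (rule ccontr)
  assume "n < i" "mu i \<noteq> 0"
  then have "i \<in> {1..part_length mu}" using partition_support[OF mu_partition] by blast
  then show False using mu_length \<open>n < i\<close> by simp
qed

lemma skew_row_le: "(i, j) \<in> S \<Longrightarrow> i \<le> part_length lam"
  by (auto simp: skew_def diagram_def)

lemma skew_col_le: "(i, j) \<in> S \<Longrightarrow> j \<le> lam 1"
  using partition_antimono[OF lam_partition, of 1 i] by (auto simp: mem_skew)

lemma finite_diagram_lam: "finite (diagram lam)"
proof (rule finite_subset)
  show "diagram lam \<subseteq> {1..part_length lam} \<times> {1..lam 1}"
    using partition_antimono[OF lam_partition, of 1] by (force simp: diagram_def)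
qed simp

lemma grid_skew: "grid S row col"
proof
  show "finite S" using finite_diagram_lam by (simp add: skew_def)
next
  fix c d assume *: "c \<in> S" "d \<in> S" "row c \<le> row d" "col c \<le> col d"
  obtain i j i' j' where cd: "c = (i, j)" "d = (i', j')" by (cases c, cases d) auto
  \<comment> \<open>The chain is \<open>mu i < j \<le> j' \<le> lam i' \<le> lam i\<close>.\<close>
  have "(i, j') \<in> S"
    using * cd partition_antimono[OF lam_partition, of i i'] by (auto simp: mem_skew)
  then show "\<exists>e\<in>S. row e = row c \<and> col e = col d" using cd by force
qed (auto simp: prod_eq_iff)

lemma dual_grid_skew: "grid S (\<lambda>c. - col c) (\<lambda>c. - row c)"
  using grid.dual_grid[OF grid_skew] .

lemma finite_skew: "finite S"
  using grid.finite_S[OF grid_skew] .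

text \<open>The positions of the column word without the entries, so that prefixes of the word
  become sets of cells independent of \<open>T\<close>.\<close>

definition cells :: "(nat \<times> nat) list" where
  "cells = concat (map (\<lambda>j. map (\<lambda>i. (i, j)) (filter (\<lambda>i. (i, j) \<in> S) [1..<Suc (part_length lam)]))
                 (rev [1..<Suc (lam 1)]))"

lemma column_word_cells: "column_word lam mu T = map T cells"
  by (simp add: column_word_def cells_def map_concat comp_def del: upt_Suc)

lemma set_cells: "set cells = S"
proof (intro subset_antisym subsetI)
  fix c assume "c \<in> S"
  moreover obtain i j where "c = (i, j)" by (cases c)
  ultimately show "c \<in> set cells"
    using skew_row_le[of i j] skew_col_le[of i j] by (force simp: cells_def mem_skew simp del: upt_Suc)
qed (auto simp: cells_def simp del: upt_Suc)

lemma sorted_cells: "sorted_wrt reading_before cells"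
  unfolding cells_def
  by (rule sorted_wrt_column_cells) (simp_all add: sorted_wrt_rev del: upt_Suc)

lemma count_take_cells:
  "count_list (take k (map T cells)) i = weight (set (take k cells)) T i"
  using count_list_map_distinct[of "take k cells" T i] distinct_reading[OF sorted_cells]
  by (simp add: take_map weight_def)

text \<open>
  Within a column \<open>i\<close> is read before \<open>i + 1\<close>, so the Yamanouchi condition need only be tested at
  the ends of columns.
\<close>

lemma yamanouchi_iff:
  assumes pos: "\<And>c. c \<in> S \<Longrightarrow> 1 \<le> T c"
    and col_strict: "\<And>i i' j. \<lbrakk>(i, j) \<in> S; (i', j) \<in> S; i < i'\<rbrakk> \<Longrightarrow> T (i, j) < T (i', j)"
  shows "yamanouchi (column_word lam mu T) \<longleftrightarrow>
    (\<forall>r k. 1 \<le> k \<longrightarrow> weight {c\<in>S. - col c \<le> r} T (Suc k) \<le> weight {c\<in>S. - col c \<le> r} T k)"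
    (is "_ \<longleftrightarrow> ?lat")
proof -
  have "0 \<notin> set (take k (map T cells))" for k
    using pos set_cells set_take_subset[of k "map T cells"] by fastforce
  then have yam: "yamanouchi (column_word lam mu T) \<longleftrightarrow> (\<forall>k\<le>length cells. \<forall>i\<ge>1.
      weight (set (take k cells)) T (Suc i) \<le> weight (set (take k cells)) T i)"
    by (simp add: yamanouchi_def column_word_cells is_partition_count_list count_take_cells)
  show ?thesis
  proof
    assume Y: "yamanouchi (column_word lam mu T)"
    show ?lat
    proof (intro allI impI)
      fix r and k :: nat assume "1 \<le> k"
      let ?P = "\<lambda>c. - col c \<le> r"
      have "takeWhile ?P cells = filter ?P cells"
        by (rule takeWhile_eq_filter[OF sorted_cells]) (auto simp: reading_before_def)
      moreover have "take (length (takeWhile ?P cells)) cells = takeWhile ?P cells"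
        by (rule takeWhile_eq_take[symmetric])
      ultimately have E: "set (take (length (takeWhile ?P cells)) cells) = {c\<in>S. ?P c}"
        by (simp add: set_cells)
      show "weight {c\<in>S. - col c \<le> r} T (Suc k) \<le> weight {c\<in>S. - col c \<le> r} T k"
        using Y[unfolded yam, rule_format, OF length_takeWhile_le[of ?P cells] \<open>1 \<le> k\<close>]
        unfolding E .
    qed
  next
    assume L: ?lat
    have "weight (set (take k cells)) T (Suc i) \<le> weight (set (take k cells)) T i"
      if k: "k \<le> length cells" and i: "1 \<le> i" for k i
    proof (cases k)
      case 0
      then show ?thesis by (simp add: weight_def)
    next
      case (Suc m)
      \<comment> \<open>The last cell read; its column may have been read only in part.\<close>
      define c0 where "c0 = cells ! m"
      let ?D = "set (take k cells)"
      have split: "cells = take m cells @ c0 # drop k cells"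
        using id_take_nth_drop[of m cells] k Suc by (simp add: c0_def)
      have tk: "take k cells = take m cells @ [c0]"
        using k Suc by (simp add: c0_def take_Suc_conv_app_nth)
      have "sorted_wrt reading_before (take m cells @ c0 # drop k cells)"
        using sorted_cells split by simp
      then have "(\<forall>c\<in>set (take m cells). reading_before c c0) \<and>
          (\<forall>c\<in>set (drop k cells). reading_before c0 c)"
        by (simp add: sorted_wrt_append)
      moreover have "S = set (take m cells) \<union> {c0} \<union> set (drop k cells)"
        using split set_cells by (metis Un_insert_right list.simps(15) set_append sup_bot_right Un_insert_left)
      ultimately have D: "?D = {c\<in>S. c = c0 \<or> reading_before c c0}"
        unfolding tk by (auto simp: reading_before_def)
      define A where "A r k = {c \<in> {c\<in>S. - col c \<le> r}. T c = k}" for r k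
      have A: "card (A r (Suc i)) \<le> card (A r i)" for r
        using L i by (simp add: A_def weight_def)
      have finA: "finite (A r k)" for r k using finite_skew by (simp add: A_def)
      have finD: "finite {c\<in>?D. T c = i}" by simp
      show ?thesis
      \<comment> \<open>If the current column has already shown \<open>i + 1\<close>, any
        \<open>i\<close> in it lies higher and has been read as well, so compare with the end of
        this column. Otherwise the column contributes no \<open>i + 1\<close> so far, and the
        columns strictly to its right suffice.\<close>
      proof (cases "\<exists>c\<in>?D. snd c = snd c0 \<and> T c = Suc i")
        case True
        then obtain c where c: "c \<in> ?D" "snd c = snd c0" "T c = Suc i" by blast
        have "A (- col c0) i \<subseteq> {d\<in>?D. T d = i}"
        proof
          fix d assume d: "d \<in> A (- col c0) i"
          have "fst d < fst c" if "snd d = snd c0"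
          proof (rule ccontr)
            assume "\<not> fst d < fst c"
            moreover have "c \<in> S" "d \<in> S" "snd c = snd d" using c d D that by (auto simp: A_def)
            ultimately have "T c \<le> T d"
              using col_strict[of "fst c" "snd c" "fst d"]
              by (cases c; cases d; cases "fst c = fst d") simp_all
            then show False using c d by (simp add: A_def)
          qed
          then show "d \<in> {d\<in>?D. T d = i}"
            using c d D by (force simp: A_def reading_before_def)
        qed
        then have "card (A (- col c0) i) \<le> weight ?D T i"
          using finD by (simp add: weight_def card_mono)
        moreover have "weight ?D T (Suc i) \<le> card (A (- col c0) (Suc i))"
          unfolding weight_def
          by (rule card_mono[OF finA]) (auto simp: A_def D reading_before_def)
        ultimately show ?thesis using A[of "- col c0"] by linarith
      next
        case False
        have "{c\<in>?D. T c = Suc i} \<subseteq> A (- col c0 - 1) (Suc i)"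
        proof
          fix c assume c: "c \<in> {c\<in>?D. T c = Suc i}"
          then have "snd c \<noteq> snd c0" using False by blast
          then show "c \<in> A (- col c0 - 1) (Suc i)"
            using c D by (auto simp: A_def reading_before_def)
        qed
        then have "weight ?D T (Suc i) \<le> card (A (- col c0 - 1) (Suc i))"
          unfolding weight_def by (rule card_mono[OF finA])
        moreover have "A (- col c0 - 1) i \<subseteq> {d\<in>?D. T d = i}"
          unfolding D by (auto simp: A_def reading_before_def)
        then have "card (A (- col c0 - 1) i) \<le> weight ?D T i"
          using finD by (simp add: weight_def card_mono)
        ultimately show ?thesis using A[of "- col c0 - 1"] by linarith
      qed
    qed
    then show "yamanouchi (column_word lam mu T)" unfolding yam by blast
  qed
qed

text \<open>Semistandardness and the Yamanouchi condition merge into admissibility in reflected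
  coordinates. The case split supplies the column strictness that \<open>yamanouchi_iff\<close>
  presupposes.\<close>

lemma LRS_iff:
  "T \<in> LRS n lam mu \<longleftrightarrow> T \<in> S \<rightarrow>\<^sub>E {1..2 * n} \<and>
     admissible S (\<lambda>c. - col c) (\<lambda>c. - row c) T \<and>
     even_partition (weight S T) \<and>
     (\<forall>i j k. (i, j) \<in> S \<and> T (i, j) = 2 * k + 1 \<longrightarrow> i \<le> n + k)"
proof (cases "T \<in> SST (2 * n) lam mu")
  case True
  then have pos: "1 \<le> T c" if "c \<in> S" for c using that by (force simp: SST_def)
  have "T (i, j) < T (i', j)" if "(i, j) \<in> S" "(i', j) \<in> S" "i < i'" for i i' j
    using True that by (auto simp: SST_def)
  then have Y: "yamanouchi (column_word lam mu T) \<longleftrightarrow>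
      (\<forall>r k. 1 \<le> k \<longrightarrow> weight {c\<in>S. - col c \<le> r} T (Suc k) \<le> weight {c\<in>S. - col c \<le> r} T k)"
    using pos by (intro yamanouchi_iff)
  have "admissible S (\<lambda>c. - col c) (\<lambda>c. - row c) T \<longleftrightarrow> yamanouchi (column_word lam mu T)"
    using True pos unfolding Y by (auto simp: admissible_def SST_def)
  then show ?thesis using True by (auto simp: LRS_def SST_def)
next
  case False
  have "T \<in> SST (2 * n) lam mu"
    if "T \<in> S \<rightarrow>\<^sub>E {1..2 * n}" "admissible S (\<lambda>c. - col c) (\<lambda>c. - row c) T"
    using that by (simp add: admissible_def SST_def Ball_def)
  then show ?thesis using False by (auto simp: LRS_def)
qed

lemma Rec_tilde_iff:
  "Q \<in> Rec_tilde n lam mu \<longleftrightarrow> Q \<in> S \<rightarrow>\<^sub>E {1..} \<and>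
     admissible S row col Q \<and>
     (\<forall>k>0. even (weight S Q k)) \<and>
     (\<forall>k>0. int (weight S Q k) \<ge>
        2 * (int (part_length (shape_of (diagram mu \<union> {c \<in> S. Q c \<ge> k}))) - int n))"
proof -
  have "(\<forall>r>0. \<forall>k>0. weight {c \<in> S. fst c \<le> r} Q (k + 1) \<le> weight {c \<in> S. fst c \<le> r} Q k) \<longleftrightarrow>
    (\<forall>r k. 1 \<le> k \<longrightarrow> weight {c\<in>S. row c \<le> r} Q (Suc k) \<le> weight {c\<in>S. row c \<le> r} Q k)"
    (is "?L \<longleftrightarrow> ?R")
  proof
    assume L: ?L
    show ?R
    proof (intro allI impI)
      fix r :: int and k :: nat assume k: "1 \<le> k"
      show "weight {c\<in>S. row c \<le> r} Q (Suc k) \<le> weight {c\<in>S. row c \<le> r} Q k"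
      \<comment> \<open>\<open>admissible\<close> tests all integers \<open>r\<close>, but rows
        start at 1, so for \<open>r \<le> 0\<close> nothing is counted.\<close>
      proof (cases "r \<le> 0")
        case True
        then have E: "{c\<in>S. row c \<le> r} = {}" by (auto simp: mem_skew)
        show ?thesis unfolding E by (simp add: weight_def)
      next
        case False
        then have "{c\<in>S. row c \<le> r} = {c\<in>S. fst c \<le> nat r}" by auto
        then show ?thesis using L k False by simp
      qed
    qed
  next
    assume R: ?R
    show ?L
    proof (intro allI impI)
      fix r k :: nat assume "0 < k"
      then show "weight {c \<in> S. fst c \<le> r} Q (k + 1) \<le> weight {c \<in> S. fst c \<le> r} Q k"
        using R[rule_format, of k "int r"] by simp
    qed
  qed
  moreover have "Q \<in> S \<rightarrow>\<^sub>E {1..} \<Longrightarrow> \<forall>c\<in>S. 1 \<le> Q c" by auto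
  ultimately show ?thesis
    by (auto simp: Rec_tilde_def admissible_def)
qed

end


section \<open>Pairs of tableaux that are companions of each other\<close>

locale tableau_pair = skew_shape +
  fixes T Q :: "nat \<times> nat \<Rightarrow> nat"
  assumes Q_admissible: "admissible S row col Q"
    and T_companion: "\<And>c. c \<in> S \<Longrightarrow> T c = companion S row Q c"
begin

sublocale QF: admissible_filling S row col Q
  using grid_skew Q_admissible by (simp add: admissible_filling_def admissible_filling_axioms_def)

lemma T_admissible: "admissible S (\<lambda>c. - col c) (\<lambda>c. - row c) T"
  using QF.companion_admissible admissible_cong[of S T "companion S row Q"] T_companion by simp

text \<open>With this the relation between \<open>T\<close> and \<open>Q\<close> becomes symmetric,
  so one locale serves whether \<open>T\<close> or \<open>Q\<close> is given first.\<close>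

lemma Q_companion: "c \<in> S \<Longrightarrow> Q c = companion S (\<lambda>c. - col c) T c"
  using QF.companion_companion companion_cong[of S T "companion S row Q" c] T_companion by simp

sublocale TF: admissible_filling S "\<lambda>c. - col c" "\<lambda>c. - row c" T
  using dual_grid_skew T_admissible
  by (simp add: admissible_filling_def admissible_filling_axioms_def)

lemma weight_iff:
  assumes "1 \<le> i" "1 \<le> k"
  shows "i \<le> weight S Q k \<longleftrightarrow> k \<le> weight S T i"
  using QF.weight_G_iff[OF assms] weight_cong[of S T "companion S row Q"] T_companion by simp

lemma weight_T_partition: "is_partition (weight S T)"
  unfolding is_partition_def
proof (intro conjI allI impI)
  have "{c\<in>S. T c = 0} = {}" using TF.F_pos by fastforce
  then show "weight S T 0 = 0" unfolding weight_def by (metis card.empty)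
next
  fix i :: nat assume "1 \<le> i"
  then show "weight S T (Suc i) \<le> weight S T i" by (intro TF.weight_F_le) auto
next
  have "{i. weight S T i \<noteq> 0} \<subseteq> T ` S"
    using finite_skew by (auto simp: weight_def)
  then show "finite {i. weight S T i \<noteq> 0}" using finite_skew finite_subset by blast
qed

text \<open>By \<open>weight_iff\<close>, column \<open>k\<close> of the diagram of the weight of
  \<open>T\<close> is the interval from 1 to \<open>weight S Q k\<close>. At the dummy index 0 both
  sides vanish.\<close>

lemma conjugate_weight: "conjugate (weight S T) = weight S Q"
proof
  fix k
  show "conjugate (weight S T) k = weight S Q k"
  proof (cases "k = 0")
    case True
    have "{c\<in>S. Q c = 0} = {}" using QF.F_pos by fastforce
    then have "weight S Q 0 = 0" unfolding weight_def by (metis card.empty)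
    then show ?thesis using True by (simp add: conjugate_def diagram_def)
  next
    case False
    then have "{i. 1 \<le> i \<and> k \<le> weight S T i} = {1..weight S Q k}"
      using weight_iff[of _ k] by auto
    then show ?thesis using False conjugate_eq_card[OF weight_T_partition, of k] by simp
  qed
qed

lemma even_weight_iff: "even_partition (weight S T) \<longleftrightarrow> (\<forall>k>0. even (weight S Q k))"
proof
  assume E: "even_partition (weight S T)"
  show "\<forall>k>0. even (weight S Q k)"
  proof (intro allI impI, rule ccontr)
    fix k assume k: "0 < k" and "odd (weight S Q k)"
    then obtain a where a: "weight S Q k = 2 * a + 1" by (auto elim: oddE)
    \<comment> \<open>Rows \<open>2a+1\<close> and \<open>2a+2\<close> have equal length, yet column
      \<open>k\<close> would end exactly between them.\<close>
    have "weight S T (2 * (a + 1) - 1) = weight S T (2 * (a + 1))"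
      using E unfolding even_partition_def by (metis le_add2)
    then show False
      using a k weight_iff[of "2 * a + 1" k] weight_iff[of "2 * a + 2" k] by simp
  qed
next
  assume E: "\<forall>k>0. even (weight S Q k)"
  have "weight S T (2 * i - 1) = weight S T (2 * i)" if i: "1 \<le> i" for i
  proof -
    let ?m = "weight S T (2 * i - 1)"
    \<comment> \<open>Column \<open>?m\<close> reaches row \<open>2i-1\<close>; its length is even,
      so it reaches row \<open>2i\<close>.\<close>
    have "?m \<le> weight S T (2 * i)"
    proof (cases "?m = 0")
      case False
      then have "2 * i - 1 \<le> weight S Q ?m"
        using weight_iff[of "2 * i - 1" ?m] i by simp
      moreover obtain b where "weight S Q ?m = 2 * b" using E False by blast
      ultimately have "2 * i \<le> weight S Q ?m" using i by simp
      then show ?thesis using weight_iff[of "2 * i" ?m] i False by simp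
    qed simp
    moreover have "weight S T (2 * i) \<le> ?m" using i by (intro TF.weight_F_le) auto
    ultimately show ?thesis by simp
  qed
  then show "even_partition (weight S T)"
    using weight_T_partition by (simp add: even_partition_def)
qed

section \<open>Superlevel sets of \<open>Q\<close> and the length condition\<close>

definition level :: "nat \<Rightarrow> (nat \<times> nat) set" where
  "level k = diagram mu \<union> {c \<in> S. Q c \<ge> k}"

text \<open>A cell outside \<open>mu\<close> that is weakly above and to the left of
  \<open>(i, j)\<close> forces \<open>(i, j)\<close> into the skew shape too, and \<open>Q\<close>
  decreases weakly from the former to the latter.\<close>

lemma level_down:
  assumes "(i, j) \<in> level k" "1 \<le> i'" "i' \<le> i" "1 \<le> j'" "j' \<le> j"
  shows "(i', j') \<in> level k"
proof (cases "(i', j') \<in> diagram mu")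
  case False
  have ij: "(i, j) \<in> diagram lam"
    using assms(1) mu_lam by (auto simp: level_def skew_def)
  have "(i', j') \<in> S"
    using False ij assms partition_antimono[OF lam_partition, of i' i]
    by (auto simp: skew_def mem_diagram_iff[OF lam_partition])
  moreover have "(i, j) \<notin> diagram mu"
    using False assms partition_antimono[OF mu_partition, of i' i]
    by (auto simp: mem_diagram_iff[OF mu_partition])
  ultimately show ?thesis
    using assms QF.F_antimono[of "(i', j')" "(i, j)"] by (auto simp: level_def)
qed (simp add: level_def)

lemma level_partition: "is_partition (shape_of (level k))"
  and diagram_level: "diagram (shape_of (level k)) = level k"
proof -
  have sub: "level k \<subseteq> diagram lam" using mu_lam by (auto simp: level_def skew_def)
  then have fin: "finite (level k)" using finite_diagram_lam finite_subset by blast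
  have pos: "1 \<le> i \<and> 1 \<le> j" if "(i, j) \<in> level k" for i j
    using sub that by (auto simp: diagram_def)
  show "is_partition (shape_of (level k))" "diagram (shape_of (level k)) = level k"
    by (rule down_closed_diagram[OF fin]; use pos level_down in blast)+
qed

lemma level_length: "1 \<le> i \<Longrightarrow> i \<le> part_length (shape_of (level k)) \<longleftrightarrow> (i, 1) \<in> level k"
proof -
  assume i: "1 \<le> i"
  have "i \<in> {i. shape_of (level k) i \<noteq> 0} \<longleftrightarrow> (i, 1) \<in> diagram (shape_of (level k))"
    using i by (auto simp: mem_diagram_iff[OF level_partition])
  then show ?thesis
    using i unfolding partition_support[OF level_partition] diagram_level by simp
qed

lemma first_column_skew:
  assumes "(i, j) \<in> diagram lam" "n < i"
  shows "(i, 1) \<in> S"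
  using assms mu_zero[of i] by (auto simp: mem_skew mem_diagram_iff[OF lam_partition])

lemma T_le_weight: "c \<in> S \<Longrightarrow> T c \<le> weight S Q (Q c)"
  using QF.G_le_weight T_companion by simp

lemma T_column:
  assumes "(i, j) \<in> S" "(i', j) \<in> S" "i < i'"
  shows "T (i, j) < T (i', j)"
  using TF.F_row[of "(i', j)" "(i, j)"] assms by simp

lemma T_row:
  assumes "(i, j) \<in> S" "(i, j') \<in> S" "j \<le> j'"
  shows "T (i, j) \<le> T (i, j')"
  using TF.F_col[of "(i, j')" "(i, j)"] assms by (cases "j = j'") auto

text \<open>\<open>T c\<close> counts cells in distinct rows, so the bound on entries follows from
  the length of \<open>lam\<close>.\<close>

lemma T_le:
  assumes "c \<in> S"
  shows "T c \<le> 2 * n"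
proof -
  let ?A = "{d\<in>S. Q d = Q c \<and> row d \<le> row c}"
  have "inj_on fst ?A"
    by (rule inj_onI) (simp add: QF.fibre_inj)
  moreover have "fst ` ?A \<subseteq> {1..part_length lam}"
    using skew_row_le by (auto simp: mem_skew)
  ultimately have "card ?A \<le> part_length lam"
    using card_inj_on_le[of fst ?A "{1..part_length lam}"] by simp
  then show ?thesis
    using lam_length T_companion[OF assms] by (simp add: companion_def)
qed

text \<open>
  Both conditions say that the entries of \<open>T\<close> in the first column satisfy \<open>T(n+p, 1) \<ge> 2p\<close>.
\<close>

lemma length_condition_iff:
  "(\<forall>k>0. int (weight S Q k) \<ge> 2 * (int (part_length (shape_of (level k))) - int n)) \<longleftrightarrow>
   (\<forall>i j k. (i, j) \<in> S \<and> T (i, j) = 2 * k + 1 \<longrightarrow> i \<le> n + k)" (is "?R4 \<longleftrightarrow> ?iii")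
proof
  assume iii: ?iii
  \<comment> \<open>Column strictness yields \<open>T (n + p + 1, 1) \<ge> 2p + 1\<close>, and (iii)
    excludes this odd value, so the bound rises by 2 per row.\<close>
  have col1: "2 * p \<le> T (n + p, 1)" if "1 \<le> p" "(n + p, 1) \<in> S" for p
    using that
  proof (induction p rule: nat_induct_at_least)
    case base
    have "T (n + 1, 1) \<noteq> 1" using iii base by fastforce
    then show ?case using TF.F_pos[OF base] by simp
  next
    case (Suc p)
    have S: "(n + p, 1) \<in> S"
      using Suc.prems Suc.hyps partition_antimono[OF lam_partition, of "n + p" "n + Suc p"]
        mu_zero[of "n + p"]
      by (auto simp: mem_skew)
    have "T (n + p, 1) < T (n + Suc p, 1)"
      using T_column[OF S Suc.prems] by simp
    moreover have "T (n + Suc p, 1) \<noteq> 2 * p + 1"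
      using iii[rule_format, of "n + Suc p" 1 p] Suc.prems by auto
    ultimately show ?case using Suc.IH[OF S] by simp
  qed
  show ?R4
  proof (intro allI impI)
    fix k :: nat assume k: "0 < k"
    define l where "l = part_length (shape_of (level k))"
    show "int (weight S Q k) \<ge> 2 * (int (part_length (shape_of (level k))) - int n)"
    proof (cases "l \<le> n")
      case True
      then show ?thesis by (simp add: l_def)
    next
      case False
      then have lev: "(l, 1) \<in> level k" using level_length[of l k] by (simp add: l_def)
      have "(l, 1) \<notin> diagram mu"
        using mu_zero[of l] False by (simp add: mem_diagram_iff[OF mu_partition])
      then have S: "(l, 1) \<in> S" and Q: "k \<le> Q (l, 1)" using lev by (auto simp: level_def)
      have "2 * (l - n) \<le> T (l, 1)"
        \<comment> \<open>The bottom cell of the first column of \<open>level k\<close> already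
          forces a rank of \<open>2 * (l - n)\<close>, and no rank exceeds the size of its
          fibre.\<close>
        using col1[of "l - n"] S False by simp
      also have "\<dots> \<le> weight S Q (Q (l, 1))" by (rule T_le_weight[OF S])
      also have "\<dots> \<le> weight S Q k" using QF.weight_F_le[of k "Q (l, 1)"] Q k by simp
      finally show ?thesis using False by (simp add: l_def)
    qed
  qed
next
  assume R4: ?R4
  show ?iii
  proof (intro allI impI, rule ccontr)
    fix i j a assume ij: "(i, j) \<in> S \<and> T (i, j) = 2 * a + 1" and "\<not> i \<le> n + a"
    then have i: "n + a < i" by simp
    have S: "(i, 1) \<in> S"
      using first_column_skew[of i j] ij i by (auto simp: skew_def)
    have j: "1 \<le> j" using ij by (auto simp: mem_skew)
    \<comment> \<open>Moving the violating cell to the first column only lowers \<open>T\<close>.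
      Strip \<open>q\<close> has \<open>T (i, 1)\<close> cells in rows up to \<open>i\<close> and at
      most one in each of the rows from \<open>i + 1\<close> to \<open>l\<close>, so (R4) gives
      \<open>2l - 2n \<le> 2a + 1 + l - i\<close>. With \<open>i \<le> l\<close> this contradicts
      \<open>n + a < i\<close>.\<close>
    define q where "q = Q (i, 1)"
    define l where "l = part_length (shape_of (level q))"
    have q: "0 < q" using QF.F_pos[OF S] by (simp add: q_def)
    have "(i, 1) \<in> level q" using S by (simp add: level_def q_def)
    then have il: "i \<le> l" using level_length[of i q] i by (simp add: l_def)
    let ?A = "{d\<in>S. Q d = q \<and> row d \<le> int i}" and ?B = "{d\<in>S. Q d = q \<and> i < fst d}"
    have "fst ` ?B \<subseteq> {i<..l}"
    proof
      fix r assume "r \<in> fst ` ?B"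
      then obtain s where s: "(r, s) \<in> S" "Q (r, s) = q" "i < r" by auto
      then have "(r, s) \<in> level q" by (simp add: level_def)
      then have "(r, 1) \<in> level q" using level_down[of r s q r 1] s by (auto simp: mem_skew)
      then show "r \<in> {i<..l}" using level_length[of r q] s by (simp add: l_def)
    qed
    moreover have "inj_on fst ?B"
      by (rule inj_onI) (simp add: QF.fibre_inj)
    ultimately have "card ?B + i \<le> l"
      using card_inj_on_le[of fst ?B "{i<..l}"] il by simp
    moreover have "card ?A = T (i, 1)"
      using T_companion[OF S] by (simp add: companion_def q_def)
    moreover have "weight S Q q \<le> card ?A + card ?B"
    proof -
      have E: "{d\<in>S. Q d = q} = ?A \<union> ?B" by auto
      show ?thesis unfolding weight_def E by (rule card_Un_le)
    qed
    moreover have "2 * l \<le> weight S Q q + 2 * n"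
      using R4[rule_format, OF q] unfolding l_def
      by (intro iffD1[OF of_nat_le_iff[where 'a = int]]) simp
    moreover have "T (i, 1) \<le> 2 * a + 1"
      using T_row[of i 1 j] S ij j by simp
    ultimately show False using i by linarith
  qed
qed

section \<open>The strip decomposition recovered from \<open>Q\<close>\<close>

lemma rightmost_cells_level:
  assumes k: "1 \<le> k"
  shows "rightmost_cells T {c\<in>S. k \<le> Q c} (weight S Q k) = {c\<in>S. Q c = k}"
proof (intro subset_antisym subsetI)
  fix c assume c: "c \<in> rightmost_cells T {c\<in>S. k \<le> Q c} (weight S Q k)"
  then have S: "c \<in> S" and kc: "k \<le> Q c" and T: "1 \<le> T c" "T c \<le> weight S Q k"
    and right: "\<And>d. \<lbrakk>d \<in> S; k \<le> Q d; T d = T c\<rbrakk> \<Longrightarrow> snd d \<le> snd c"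
    by (auto simp: rightmost_cells_def)
  \<comment> \<open>Value \<open>k\<close> has a cell \<open>d\<close> with the same entry of
    \<open>T\<close>; if \<open>Q c\<close> exceeded \<open>k\<close>, \<open>G_fibre_y\<close>
    would place \<open>d\<close> strictly to the right of \<open>c\<close>.\<close>
  obtain d where d: "d \<in> S" "Q d = k" "T d = T c"
    using QF.G_surj[OF T] T_companion by metis
  have "\<not> Q d < Q c"
    using QF.G_fibre_y[of d c] d S T_companion right[OF d(1)] by auto
  then show "c \<in> {c\<in>S. Q c = k}" using kc d S by simp
next
  fix c assume c: "c \<in> {c\<in>S. Q c = k}"
  have "snd d \<le> snd c" if d: "d \<in> S" "k \<le> Q d" "T d = T c" for d
  proof (cases "Q d = k")
    case True
    then have "d = c" using QF.G_inj[of d c] c d T_companion by simp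
    then show ?thesis by simp
  next
    case False
    then show ?thesis using QF.G_fibre_y[of c d] c d T_companion by simp
  qed
  then show "c \<in> rightmost_cells T {c\<in>S. k \<le> Q c} (weight S Q k)"
    using c TF.F_pos[of c] T_le_weight[of c] by (auto simp: rightmost_cells_def)
qed

text \<open>The shift arises because \<open>stage\<close> counts the strips removed, while
  \<open>level k\<close> keeps the cells with value at least \<open>k\<close>.\<close>

lemma stage_level: "stage lam mu T k = level (Suc k)"
proof (induction k)
  case 0
  have "Suc 0 \<le> Q c" if "c \<in> S" for c using QF.F_pos[OF that] by simp
  then show ?case using mu_lam by (auto simp: level_def skew_def)
next
  case (Suc k)
  have "level (Suc k) - diagram mu = {c\<in>S. Suc k \<le> Q c}"
    by (auto simp: level_def skew_def)
  then have "stage lam mu T (Suc k) = level (Suc k) - {c\<in>S. Q c = Suc k}"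
    using Suc rightmost_cells_level[of "Suc k"] by (simp add: conjugate_weight)
  also have "\<dots> = level (Suc (Suc k))"
    by (auto simp: level_def skew_def)
  finally show ?case .
qed

lemma strip_eq:
  assumes "1 \<le> k"
  shows "strip lam mu T k = {c\<in>S. Q c = k}"
proof -
  have "level k - diagram mu = {c\<in>S. k \<le> Q c}"
    by (auto simp: level_def skew_def)
  then show ?thesis
    using assms rightmost_cells_level[OF assms]
    by (simp add: strip_def stage_level conjugate_weight)
qed

lemma Q_le: "c \<in> S \<Longrightarrow> Q c \<le> weight S T 1"
  using TF.G_le_weight[of c] TF.weight_F_le[of 1 "T c"] TF.F_pos[of c] Q_companion[of c] by simp

text \<open>Each cell lies in the strip with index \<open>Q c\<close> and in no other, so the
  recursive construction is the ranking operation.\<close>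

lemma lozenge_eq: "lozenge lam mu T = restrict Q S"
  unfolding lozenge_def
proof (rule restrict_ext)
  fix c assume c: "c \<in> S"
  show "(THE k. k \<in> {1..weight S T 1} \<and> c \<in> strip lam mu T k) = Q c"
    using c Q_le[OF c] QF.F_pos[OF c] by (intro the_equality) (auto simp: strip_eq)
qed

lemma weight_lozenge: "weight S (lozenge lam mu T) = conjugate (weight S T)"
  unfolding conjugate_weight lozenge_eq by (rule weight_cong) simp

lemma strips_disjoint: "disjoint_family_on (strip lam mu T) {1..weight S T 1}"
  by (auto simp: disjoint_family_on_def strip_eq)

lemma strips_cover: "(\<Union>k\<in>{1..weight S T 1}. strip lam mu T k) = S"
proof -
  have "(\<Union>k\<in>{1..weight S T 1}. strip lam mu T k) = (\<Union>k\<in>{1..weight S T 1}. {c\<in>S. Q c = k})"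
    by (simp add: strip_eq)
  also have "\<dots> = S" using Q_le QF.F_pos by auto
  finally show ?thesis .
qed

lemma strip_vertical:
  assumes "1 \<le> k"
  shows "is_vertical_strip (strip lam mu T k)"
  unfolding is_vertical_strip_def
proof (intro conjI allI exI)
  \<comment> \<open>The strip is the difference of two consecutive superlevel sets.\<close>
  show "is_partition (shape_of (level k))" "is_partition (shape_of (level (Suc k)))"
    by (rule level_partition)+
  show "diagram (shape_of (level (Suc k))) \<subseteq> diagram (shape_of (level k))"
    unfolding diagram_level by (auto simp: level_def)
  show "strip lam mu T k = skew (shape_of (level k)) (shape_of (level (Suc k)))"
    unfolding strip_eq[OF assms] skew_def[of "shape_of (level k)"] diagram_level
    by (auto simp: level_def skew_def)
next
  fix i
  have "j = j'" if "(i, j) \<in> S" "Q (i, j) = k" "(i, j') \<in> S" "Q (i, j') = k" for j j'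
    using QF.fibre_inj[of "(i, j)" "(i, j')"] that by simp
  then have "is_singleton {j. (i, j) \<in> strip lam mu T k} \<or> {j. (i, j) \<in> strip lam mu T k} = {}"
    unfolding strip_eq[OF assms] is_singleton_def by blast
  then show "card {j. (i, j) \<in> strip lam mu T k} \<le> 1"
    by (auto simp: is_singleton_altdef)
qed

lemma strip_bij:
  assumes "1 \<le> k"
  shows "bij_betw T (strip lam mu T k) {1..conjugate (weight S T) k}"
proof -
  have "bij_betw T {c\<in>S. Q c = k} {1..weight S Q k} \<longleftrightarrow>
      bij_betw (companion S row Q) {c\<in>S. Q c = k} {1..weight S Q k}"
    using T_companion by (intro bij_betw_cong) simp
  then show ?thesis
    using QF.G_bij[of k] by (simp add: strip_eq[OF assms] conjugate_weight)
qed

lemma card_strip: "1 \<le> k \<Longrightarrow> card (strip lam mu T k) = conjugate (weight S T) k"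
  using bij_betw_same_card[OF strip_bij] by simp

lemma strip_increasing:
  assumes "1 \<le> k" "c \<in> strip lam mu T k" "d \<in> strip lam mu T k" "fst c < fst d"
  shows "T c < T d"
  using assms QF.G_less[of c d] T_companion by (simp add: strip_eq)

end

section \<open>The bijection\<close>

context skew_shape
begin

text \<open>Reflecting twice restores (row, column), so the companion of \<open>T\<close> is
  admissible there, and its own companion is \<open>T\<close> again.\<close>

lemma tableau_pair_of_LRS:
  assumes "T \<in> LRS n lam mu"
  shows "tableau_pair lam mu n T (companion S (\<lambda>c. - col c) T)"
proof -
  have "admissible S (\<lambda>c. - col c) (\<lambda>c. - row c) T" using assms by (simp add: LRS_iff)
  then interpret A: admissible_filling S "\<lambda>c. - col c" "\<lambda>c. - row c" T
    using dual_grid_skew by (simp add: admissible_filling_def admissible_filling_axioms_def)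
  show ?thesis
    using A.companion_admissible A.companion_companion
    by unfold_locales simp_all
qed

lemma tableau_pair_of_Rec_tilde:
  assumes "Q \<in> Rec_tilde n lam mu"
  shows "tableau_pair lam mu n (restrict (companion S row Q) S) Q"
  using assms by unfold_locales (simp_all add: Rec_tilde_iff)

lemma lozenge_Rec_tilde:
  assumes "T \<in> LRS n lam mu"
  shows "lozenge lam mu T \<in> Rec_tilde n lam mu"
proof -
  define Q where "Q = companion S (\<lambda>c. - col c) T"
  interpret P: tableau_pair lam mu n T Q
    unfolding Q_def by (rule tableau_pair_of_LRS[OF assms])
  \<comment> \<open>\<open>lozenge\<close> yields an extensional filling; it agrees with
    \<open>Q\<close> on \<open>S\<close>, which leaves weights and superlevel sets
    unchanged.\<close>
  let ?R = "restrict Q S"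
  have "{c\<in>S. ?R c \<ge> k} = {c\<in>S. Q c \<ge> k}" for k by auto
  then have lev: "diagram mu \<union> {c\<in>S. ?R c \<ge> k} = P.level k" for k
    by (simp add: P.level_def)
  have w: "weight S ?R = weight S Q" by (rule weight_cong) simp
  have "admissible S row col ?R"
    using P.Q_admissible admissible_cong[of S ?R Q] by simp
  then show ?thesis
    unfolding P.lozenge_eq Rec_tilde_iff lev w
    using assms P.even_weight_iff P.length_condition_iff P.QF.F_pos by (auto simp: LRS_iff)
qed

lemma inj_on_lozenge: "inj_on (lozenge lam mu) (LRS n lam mu)"
proof (rule inj_onI)
  fix T T' assume T: "T \<in> LRS n lam mu" and T': "T' \<in> LRS n lam mu"
    and eq: "lozenge lam mu T = lozenge lam mu T'"
  define Q Q' where "Q = companion S (\<lambda>c. - col c) T" and "Q' = companion S (\<lambda>c. - col c) T'"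
  interpret P: tableau_pair lam mu n T Q
    unfolding Q_def by (rule tableau_pair_of_LRS[OF T])
  interpret P': tableau_pair lam mu n T' Q'
    unfolding Q'_def by (rule tableau_pair_of_LRS[OF T'])
  have "Q c = Q' c" if "c \<in> S" for c
    using eq that unfolding P.lozenge_eq P'.lozenge_eq by (metis restrict_apply')
  \<comment> \<open>\<open>T\<close> is recovered from its image as the companion.\<close>
  then have "T c = T' c" if "c \<in> S" for c
    using P.T_companion P'.T_companion companion_cong[of S Q Q' c] that by simp
  moreover have "T \<in> extensional S" "T' \<in> extensional S"
    using T T' by (auto simp: LRS_iff PiE_def)
  ultimately show "T = T'" by (intro extensionalityI)
qed

lemma lozenge_surj:
  assumes "Q \<in> Rec_tilde n lam mu"
  shows "\<exists>T\<in>LRS n lam mu. lozenge lam mu T = Q"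
proof -
  define T where "T = restrict (companion S row Q) S"
  interpret P: tableau_pair lam mu n T Q
    unfolding T_def by (rule tableau_pair_of_Rec_tilde[OF assms])
  have "T \<in> S \<rightarrow>\<^sub>E {1..2 * n}"
  proof (rule PiE_I)
    fix c assume "c \<in> S"
    then show "T c \<in> {1..2 * n}" using P.TF.F_pos[of c] P.T_le[of c] by simp
  qed (simp add: T_def)
  then have "T \<in> LRS n lam mu"
    using assms P.T_admissible P.even_weight_iff P.length_condition_iff
    by (simp add: LRS_iff Rec_tilde_iff P.level_def)
  moreover have "lozenge lam mu T = Q"
    unfolding P.lozenge_eq using assms by (auto simp: Rec_tilde_iff PiE_def extensional_restrict)
  ultimately show ?thesis by blast
qed

lemma bij_betw_lozenge: "bij_betw (lozenge lam mu) (LRS n lam mu) (Rec_tilde n lam mu)"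
  unfolding bij_betw_def using inj_on_lozenge lozenge_Rec_tilde lozenge_surj by blast

end

theorem theoremA:
  fixes n :: nat and lam mu :: "nat \<Rightarrow> nat"
  assumes "n \<ge> 1"
    and "lam \<in> Par_le (2 * n)"
    and "mu \<in> Par_le n"
    and "diagram mu \<subseteq> diagram lam"
  shows "(\<forall>T \<in> LRS n lam mu. \<forall>\<nu>. \<nu> = weight (skew lam mu) T \<longrightarrow>
            disjoint_family_on (strip lam mu T) {1..\<nu> 1} \<and>
            (\<Union>k\<in>{1..\<nu> 1}. strip lam mu T k) = skew lam mu \<and>
            (\<forall>k\<in>{1..\<nu> 1}.
               is_vertical_strip (strip lam mu T k) \<and>
               card (strip lam mu T k) = conjugate \<nu> k \<and>
               even (conjugate \<nu> k) \<and>
               bij_betw T (strip lam mu T k) {1..conjugate \<nu> k} \<and>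
               (\<forall>c\<in>strip lam mu T k. \<forall>d\<in>strip lam mu T k. fst c < fst d \<longrightarrow> T c < T d)) \<and>
            lozenge lam mu T \<in> Rec_tilde n lam mu \<and>
            weight (skew lam mu) (lozenge lam mu T) = conjugate \<nu>) \<and>
         bij_betw (lozenge lam mu) (LRS n lam mu) (Rec_tilde n lam mu)"
proof -
  interpret skew_shape lam mu n
    using assms by unfold_locales
  show ?thesis
  proof (intro conjI ballI allI impI)
    fix T \<nu> assume T: "T \<in> LRS n lam mu" and \<nu>: "\<nu> = weight S T"
    interpret P: tableau_pair lam mu n T "companion S (\<lambda>c. - col c) T"
      by (rule tableau_pair_of_LRS[OF T])
    show "disjoint_family_on (strip lam mu T) {1..\<nu> 1}"
      and "(\<Union>k\<in>{1..\<nu> 1}. strip lam mu T k) = S"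
      and "weight S (lozenge lam mu T) = conjugate \<nu>"
      unfolding \<nu> by (rule P.strips_disjoint P.strips_cover P.weight_lozenge)+
    show "lozenge lam mu T \<in> Rec_tilde n lam mu"
      by (rule lozenge_Rec_tilde[OF T])
    fix k assume "k \<in> {1..\<nu> 1}"
    then have k: "1 \<le> k" by simp
    show "is_vertical_strip (strip lam mu T k)"
      and "card (strip lam mu T k) = conjugate \<nu> k"
      and "bij_betw T (strip lam mu T k) {1..conjugate \<nu> k}"
      unfolding \<nu> using P.strip_vertical P.card_strip P.strip_bij k by blast+
    show "even (conjugate \<nu> k)"
      using T P.even_weight_iff k by (simp add: \<nu> P.conjugate_weight LRS_iff)
    show "T c < T d" if "c \<in> strip lam mu T k" "d \<in> strip lam mu T k" "fst c < fst d" for c d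
      using P.strip_increasing[OF k that] .
  qed (rule bij_betw_lozenge)
qed

end
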